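(* Let $\mathcal U_k\subseteq\mathcal H$ be linear subspaces and let $\Pi_k$ be their orthogonal projectors. Suppose $$\sup_k\|B_k-G_\star\|<\infty,\qquad \frac{\|(I-\Pi_k)d_k\|}{\|d_k\|}\to0,\qquad \|(B_k-G_\star)\Pi_k\|\to0 .$$ Then $$\frac{\|(B_k-\overline G_k)d_k\|}{\|d_k\|}\longrightarrow0 .$$
   Context: $\mathcal H$ is a finite-dimensional real Hilbert space, $f:\mathcal H\to\mathbb R$ is convex and twice continuously differentiable, $\gamma>0$, and $P_{\gamma f}z:=\arg\min_x\{\gamma f(x)+\frac12\|x-z\|^2\}$. For a sequence of centers $z_k$ and anchors $a_{k-1}$, $\phi_k(x):=\gamma f(x)+\frac12\|x-z_k\|^2$, $p_k:=P_{\gamma f}z_k$, $d_k:=a_{k-1}-p_k$; it is assumed that $d_k\neq0$, $d_k\to0$, $a_{k-1}\to p_\star$ and $p_k\to p_\star$, where $p_\star=P_{\gamma f}z_\star$ for the exact DRS fixed point $z_\star$. Further, $$\overline G_k:=\int_0^1\nabla^2\phi_k(p_k+td_k)\,dt=\int_0^1\bigl(I+\gamma\nabla^2f(p_k+td_k)\bigr)dt,\qquad G_\star:=I+\gamma\nabla^2f(p_\star).$$ $B_k$ are self-adjoint positive definite operators on $\mathcal H$ (direct quasi-Newton Hessian models). *)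

theory Defs
  imports "HOL-Analysis.Analysis"
begin

definition grad :: "('a::euclidean_space \<Rightarrow> real) \<Rightarrow> 'a \<Rightarrow> 'a" where
  "grad f x = (THE D. GDERIV f x :> D)"

text \<open>The Hessian is the derivative of the gradient field, as a bounded operator on the space,
  so that its continuity and the norms of operators refer to the operator norm.\<close>

definition hessian :: "('a::euclidean_space \<Rightarrow> real) \<Rightarrow> 'a \<Rightarrow> 'a \<Rightarrow>\<^sub>L 'a" where
  "hessian f x = Blinfun (frechet_derivative (grad f) (at x))"

definition twice_continuously_differentiable :: "('a::euclidean_space \<Rightarrow> real) \<Rightarrow> bool" where
  "twice_continuously_differentiable f \<longleftrightarrow>
     (\<forall>x. f differentiable (at x)) \<and>
     (\<forall>x. grad f differentiable (at x)) \<and>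
     continuous_on UNIV (hessian f)"

definition prox_objective :: "real \<Rightarrow> ('a::euclidean_space \<Rightarrow> real) \<Rightarrow> 'a \<Rightarrow> 'a \<Rightarrow> real" where
  "prox_objective \<gamma> f z x = \<gamma> * f x + (1/2) * (norm (x - z))\<^sup>2"

definition prox :: "real \<Rightarrow> ('a::euclidean_space \<Rightarrow> real) \<Rightarrow> 'a \<Rightarrow> 'a" where
  "prox \<gamma> f z = arg_min (prox_objective \<gamma> f z) (\<lambda>x. True)"

definition self_adjoint :: "('a::euclidean_space \<Rightarrow>\<^sub>L 'a) \<Rightarrow> bool" where
  "self_adjoint A \<longleftrightarrow> (\<forall>x y. blinfun_apply A x \<bullet> y = x \<bullet> blinfun_apply A y)"

definition positive_definite :: "('a::euclidean_space \<Rightarrow>\<^sub>L 'a) \<Rightarrow> bool" where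
  "positive_definite A \<longleftrightarrow> (\<forall>x. x \<noteq> 0 \<longrightarrow> blinfun_apply A x \<bullet> x > 0)"

definition is_orthogonal_projector :: "'a::euclidean_space set \<Rightarrow> ('a \<Rightarrow>\<^sub>L 'a) \<Rightarrow> bool" where
  "is_orthogonal_projector U P \<longleftrightarrow>
     (\<forall>x. blinfun_apply P x \<in> U \<and> x - blinfun_apply P x \<in> U\<^sup>\<bottom>)"

end

theory Submission
  imports Defs
begin

text \<open>Since the Hessian of the prox objective is \<open>I + \<gamma> \<nabla>\<^sup>2f\<close>, independently of the center, and the
  segments from \<open>p\<^sub>k\<close> to \<open>p\<^sub>k + d\<^sub>k\<close> shrink to \<open>p\<^sub>\<star>\<close>, the averaged Hessians converge to \<open>G\<^sub>\<star>\<close>.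
  It remains to split \<open>(B\<^sub>k - G\<^sub>\<star>) d\<^sub>k\<close> along \<open>\<Pi>\<^sub>k\<close>: the captured part is small by operator
  convergence on \<open>U\<^sub>k\<close>, the rest by boundedness of \<open>B\<^sub>k - G\<^sub>\<star>\<close>.\<close>

text \<open>\<open>grad\<close> is a definite description, so evaluating it takes uniqueness:
  derivatives are unique, and a vector is determined by its inner products.\<close>

lemma GDERIV_imp_grad_eq:
  assumes "GDERIV f x :> D"
  shows "grad f x = D"
  unfolding grad_def
proof (rule the_equality[where P = "\<lambda>D. GDERIV f x :> D", OF assms])
  fix D' assume "GDERIV f x :> D'"
  then have "(\<lambda>h. h \<bullet> D') = (\<lambda>h. h \<bullet> D)"
    using assms unfolding gderiv_def by (rule has_derivative_unique)
  then show "D' = D"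
    by (metis vector_eq_ldot)
qed

lemma GDERIV_grad:
  fixes f :: "'a::euclidean_space \<Rightarrow> real"
  assumes "f differentiable (at x)"
  shows "GDERIV f x :> grad f x"
proof -
  obtain f' where f': "(f has_derivative f') (at x)"
    using assms unfolding differentiable_def by blast
  then have "linear f'"
    using has_derivative_linear by blast
  \<comment> \<open>Riesz representation: \<open>f' h\<close> is the real inner product of
    \<open>f' h\<close> with 1, and the adjoint moves \<open>f'\<close> onto the 1.\<close>
  then have "f' = (\<lambda>h. h \<bullet> adjoint f' 1)"
    using adjoint_works[of f'] by force
  with f' have "GDERIV f x :> adjoint f' 1"
    unfolding gderiv_def by simp
  then show ?thesis
    using GDERIV_imp_grad_eq by metis
qed

lemma grad_prox_objective:
  fixes f :: "'a::euclidean_space \<Rightarrow> real"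
  assumes "f differentiable (at x)"
  shows "grad (prox_objective \<gamma> f z) x = \<gamma> *\<^sub>R grad f x + (x - z)"
proof (rule GDERIV_imp_grad_eq)
  \<comment> \<open>As an inner product, the quadratic term falls under the product rule, also at
    \<open>x = z\<close>, where the norm itself is not differentiable.\<close>
  have *: "prox_objective \<gamma> f z = (\<lambda>x. \<gamma> * f x + (1/2) * ((x - z) \<bullet> (x - z)))"
    by (simp add: fun_eq_iff prox_objective_def power2_norm_eq_inner)
  have "(f has_derivative (\<lambda>h. h \<bullet> grad f x)) (at x)"
    using GDERIV_grad[OF assms] by (simp add: gderiv_def)
  then show "GDERIV (prox_objective \<gamma> f z) x :> \<gamma> *\<^sub>R grad f x + (x - z)"
    unfolding gderiv_def *
    by (auto intro!: derivative_eq_intros simp: inner_simps inner_commute algebra_simps)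
qed

text \<open>The quadratic term adds the identity to the derivative of the gradient, and the center
  only shifts that gradient by a constant. First-order differentiability is assumed at every point
  because the gradient formula is differentiated as an identity of functions.\<close>

lemma hessian_prox_objective:
  fixes f :: "'a::euclidean_space \<Rightarrow> real"
  assumes "\<And>y. f differentiable (at y)" and "grad f differentiable (at x)"
  shows "hessian (prox_objective \<gamma> f z) x = id_blinfun + \<gamma> *\<^sub>R hessian f x"
proof -
  let ?D = "frechet_derivative (grad f) (at x)"
  have D: "(grad f has_derivative ?D) (at x)"
    using assms(2) frechet_derivative_works by blast
  \<comment> \<open>\<open>Blinfun\<close> is inverted by \<open>blinfun_apply\<close> only on
    bounded linear maps.\<close>
  then have "bounded_linear ?D"
    by (rule has_derivative_bounded_linear)
  then have ap: "blinfun_apply (hessian f x) = ?D"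
    by (simp add: hessian_def bounded_linear_Blinfun_apply)
  have "grad (prox_objective \<gamma> f z) = (\<lambda>x. \<gamma> *\<^sub>R grad f x + (x - z))"
    using grad_prox_objective[OF assms(1)] by blast
  then have "(grad (prox_objective \<gamma> f z) has_derivative
      blinfun_apply (id_blinfun + \<gamma> *\<^sub>R hessian f x)) (at x)"
    using D by (auto intro!: derivative_eq_intros simp: ap blinfun.bilinear_simps)
  then have "blinfun_apply (id_blinfun + \<gamma> *\<^sub>R hessian f x) = 
      frechet_derivative (grad (prox_objective \<gamma> f z)) (at x)"
    by (rule frechet_derivative_at)
  then show ?thesis
    unfolding hessian_def[of "prox_objective \<gamma> f z"] by (metis blinfun_apply_inverse)
qed

text \<open>Balls are convex: once both endpoints lie in a small ball around \<open>q\<close>, so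
  does the whole segment, and the integrand is close to \<open>h q\<close> for all \<open>t\<close>
  at once.\<close>

lemma tendsto_integral_segment:
  fixes h :: "'a::real_normed_vector \<Rightarrow> 'b::banach"
  assumes h: "continuous_on UNIV h"
    and p: "p \<longlonglongrightarrow> q" and d: "d \<longlonglongrightarrow> 0"
  shows "(\<lambda>k. integral {0..1} (\<lambda>t. h (p k + t *\<^sub>R d k))) \<longlonglongrightarrow> h q"
proof (rule LIMSEQ_I)
  fix e :: real assume "e > 0"
  have "isCont h q"
    using h continuous_on_eq_continuous_at by blast
  \<comment> \<open>The integral bound below yields only a non-strict inequality; aiming at
    \<open>e / 2\<close> makes the final one strict.\<close>
  then obtain r where "r > 0" and r: "\<And>x. dist x q < r \<Longrightarrow> dist (h x) (h q) < e / 2"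
    using \<open>e > 0\<close> unfolding continuous_at_eps_delta by (metis half_gt_zero)
  have pd: "(\<lambda>k. p k + d k) \<longlonglongrightarrow> q"
    using tendsto_add[OF p d] by simp
  have "\<forall>\<^sub>F k in sequentially. dist (p k) q < r \<and> dist (p k + d k) q < r"
    using tendstoD[OF p \<open>r > 0\<close>] tendstoD[OF pd \<open>r > 0\<close>] by (rule eventually_conj)
  then obtain N where N: "\<And>k. k \<ge> N \<Longrightarrow> p k \<in> ball q r \<and> p k + d k \<in> ball q r"
    unfolding eventually_sequentially by (auto simp: dist_commute)
  have "norm (integral {0..1} (\<lambda>t. h (p k + t *\<^sub>R d k)) - h q) < e" if "k \<ge> N" for k
  proof -
    let ?g = "\<lambda>t::real. h (p k + t *\<^sub>R d k)"
    have cont: "continuous_on {0..1} (\<lambda>t. ?g t - h q)"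
      by (intro continuous_intros continuous_on_compose2[OF h]) auto
    have bound: "norm (?g t - h q) \<le> e / 2" if t: "t \<in> {0..1}" for t
    proof -
      have "(1 - t) *\<^sub>R p k + t *\<^sub>R (p k + d k) \<in> ball q r"
        using N[OF \<open>k \<ge> N\<close>] t by (intro convexD[OF convex_ball]) auto
      then have "p k + t *\<^sub>R d k \<in> ball q r"
        by (simp add: algebra_simps)
      then show ?thesis
        using r[of "p k + t *\<^sub>R d k"] by (simp add: dist_commute flip: dist_norm)
    qed
    have "?g integrable_on {0..1}"
      by (intro integrable_continuous_real continuous_on_compose2[OF h] continuous_intros) auto
    \<comment> \<open>The interval has length 1, so \<open>h q\<close> is the integral of its own
      constant function.\<close>
    then have "integral {0..1} ?g - h q = integral {0..1} (\<lambda>t. ?g t - h q)"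
      by (subst integral_diff) auto
    moreover have "norm (integral {0..1} (\<lambda>t. ?g t - h q)) \<le> e / 2 * (1 - 0)"
      by (rule integral_bound[OF _ cont]) (use bound in auto)
    ultimately show ?thesis
      using \<open>e > 0\<close> by simp
  qed
  then show "\<exists>N. \<forall>k\<ge>N. norm (integral {0..1} (\<lambda>t. h (p k + t *\<^sub>R d k)) - h q) < e"
    by blast
qed

theorem proposition5p3:
  fixes f :: "'a::euclidean_space \<Rightarrow> real"
    and \<gamma> :: real
    and z a p d :: "nat \<Rightarrow> 'a"
    and z\<^sub>s p\<^sub>s :: 'a
    and B Gbar Proj :: "nat \<Rightarrow> 'a \<Rightarrow>\<^sub>L 'a"
    and G\<^sub>s :: "'a \<Rightarrow>\<^sub>L 'a"
    and U :: "nat \<Rightarrow> 'a set"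
  assumes f_convex: "convex_on UNIV f"
    and f_C2: "twice_continuously_differentiable f"
    and gamma_pos: "\<gamma> > 0"
    and p_eq: "\<And>k. k \<ge> 1 \<Longrightarrow> p k = prox \<gamma> f (z k)"
    and d_eq: "\<And>k. k \<ge> 1 \<Longrightarrow> d k = a (k - 1) - p k"
    and ps_eq: "p\<^sub>s = prox \<gamma> f z\<^sub>s"
    and d_nonzero: "\<And>k. k \<ge> 1 \<Longrightarrow> d k \<noteq> 0"
    and d_lim: "d \<longlonglongrightarrow> 0"
    and a_lim: "(\<lambda>k. a (k - 1)) \<longlonglongrightarrow> p\<^sub>s"
    and p_lim: "p \<longlonglongrightarrow> p\<^sub>s"
    and Gbar_eq: "\<And>k. k \<ge> 1 \<Longrightarrow>
      Gbar k = integral {0..1} (\<lambda>t. hessian (prox_objective \<gamma> f (z k)) (p k + t *\<^sub>R d k))"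
    and Gs_eq: "G\<^sub>s = id_blinfun + \<gamma> *\<^sub>R hessian f p\<^sub>s"
    and B_self_adjoint: "\<And>k. k \<ge> 1 \<Longrightarrow> self_adjoint (B k)"
    and B_pos_def: "\<And>k. k \<ge> 1 \<Longrightarrow> positive_definite (B k)"
    and U_subspace: "\<And>k. k \<ge> 1 \<Longrightarrow> subspace (U k)"
    and Proj_projector: "\<And>k. k \<ge> 1 \<Longrightarrow> is_orthogonal_projector (U k) (Proj k)"
    and B_bdd: "bdd_above ((\<lambda>k. norm (B k - G\<^sub>s)) ` {1..})"
    and d_capture: "(\<lambda>k. norm (blinfun_apply (id_blinfun - Proj k) (d k)) / norm (d k)) \<longlonglongrightarrow> 0"
    and B_on_U: "(\<lambda>k. norm ((B k - G\<^sub>s) o\<^sub>L Proj k)) \<longlonglongrightarrow> 0"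
  shows "(\<lambda>k. norm (blinfun_apply (B k - Gbar k) (d k)) / norm (d k)) \<longlonglongrightarrow> 0"
proof -
  have df: "\<And>x. f differentiable (at x)" and dg: "\<And>x. grad f differentiable (at x)"
    and ch: "continuous_on UNIV (hessian f)"
    using f_C2 unfolding twice_continuously_differentiable_def by auto
  let ?H = "\<lambda>x. id_blinfun + \<gamma> *\<^sub>R hessian f x"
  have "(\<lambda>k. integral {0..1} (\<lambda>t. ?H (p k + t *\<^sub>R d k))) \<longlonglongrightarrow> ?H p\<^sub>s"
    by (intro tendsto_integral_segment p_lim d_lim continuous_intros ch)
  \<comment> \<open>The formula for \<open>Gbar\<close> is available only from index 1 on, hence an
    eventual equality.\<close>
  moreover have "\<forall>\<^sub>F k in sequentially. integral {0..1} (\<lambda>t. ?H (p k + t *\<^sub>R d k)) = Gbar k"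
    using eventually_ge_at_top[of 1]
    by eventually_elim (simp add: Gbar_eq hessian_prox_objective[OF df dg])
  ultimately have "Gbar \<longlonglongrightarrow> G\<^sub>s"
    unfolding Gs_eq by (rule Lim_transform_eventually)
  then have Gbar_lim: "(\<lambda>k. norm (G\<^sub>s - Gbar k)) \<longlonglongrightarrow> 0"
    using tendsto_norm[OF tendsto_diff[OF tendsto_const[of G\<^sub>s]]] by fastforce
  obtain M where M: "\<And>k. k \<ge> 1 \<Longrightarrow> norm (B k - G\<^sub>s) \<le> M"
    using B_bdd unfolding bdd_above_def by auto
  let ?r = "\<lambda>k. norm (blinfun_apply (id_blinfun - Proj k) (d k)) / norm (d k)"
  \<comment> \<open>One summand for each piece of
    \<open>(B - G) Proj + (B - G) (I - Proj) + (G - Gbar)\<close>, applied to \<open>d k\<close> and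
    divided by its norm.\<close>
  let ?b = "\<lambda>k. norm ((B k - G\<^sub>s) o\<^sub>L Proj k) + M * ?r k + norm (G\<^sub>s - Gbar k)"
  have "?b \<longlonglongrightarrow> 0"
    using tendsto_add[OF tendsto_add[OF B_on_U tendsto_mult_left[OF d_capture, of M]] Gbar_lim]
    by simp
  moreover have "\<forall>\<^sub>F k in sequentially.
      norm (norm (blinfun_apply (B k - Gbar k) (d k)) / norm (d k)) \<le> ?b k"
    using eventually_ge_at_top[of 1]
  proof eventually_elim
    case (elim k)
    let ?x = "blinfun_apply ((B k - G\<^sub>s) o\<^sub>L Proj k) (d k)"
    let ?v = "blinfun_apply (id_blinfun - Proj k) (d k)"
    let ?y = "blinfun_apply (B k - G\<^sub>s) ?v"
    let ?w = "blinfun_apply (G\<^sub>s - Gbar k) (d k)"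
    have "blinfun_apply (B k - Gbar k) (d k) = ?x + ?y + ?w"
      by (simp add: blinfun.bilinear_simps)
    then have "norm (blinfun_apply (B k - Gbar k) (d k)) \<le> norm ?x + norm ?y + norm ?w"
      by (simp only: norm_triangle_le norm_triangle_ineq add_right_mono)
    also have "norm ?x \<le> norm ((B k - G\<^sub>s) o\<^sub>L Proj k) * norm (d k)"
      by (rule norm_blinfun)
    also have "norm ?w \<le> norm (G\<^sub>s - Gbar k) * norm (d k)"
      by (rule norm_blinfun)
    also have "norm ?y \<le> norm (B k - G\<^sub>s) * norm ?v"
      by (rule norm_blinfun)
    also have "\<dots> \<le> M * norm ?v"
      using M[OF elim] by (rule mult_right_mono) simp
    \<comment> \<open>Since \<open>d k\<close> is nonzero, \<open>norm ?v\<close> equals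
      \<open>?r k * norm (d k)\<close>, so the common factor can be pulled out.\<close>
    finally have "norm (blinfun_apply (B k - Gbar k) (d k)) \<le> ?b k * norm (d k)"
      using d_nonzero[OF elim] by (simp add: distrib_right)
    then show ?case
      using d_nonzero[OF elim] by (simp add: pos_divide_le_eq)
  qed
  ultimately show ?thesis
    by (rule Lim_null_comparison[rotated])
qed

end
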